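(* Let $n>2$ be an integer and let ${}_n\mathcal{A}$ be the $g_n\times g_n$ matrix of $n$-variable rotation symmetric Boolean functions (defined in the context). Then every eigenvalue of ${}_n\mathcal{A}$ is $2^{n/2}$ or $-2^{n/2}$, and, counting eigenvalues with algebraic multiplicity: \begin{itemize} \item if $n$ is odd, each of $2^{n/2}$ and $-2^{n/2}$ occurs exactly $g_n/2$ times; \item if $n$ is even, the number of positive eigenvalues (i.e. the multiplicity of $2^{n/2}$) is $$\frac{g_n}{2}+\frac{1}{2n}\sum_{\substack{k\mid n\\ 2\mid k}}\phi(k)\,2^{n/k},$$ and the number of negative eigenvalues (i.e. the multiplicity of $-2^{n/2}$) is $$\frac{g_n}{2}-\frac{1}{2n}\sum_{\substack{k\mid n\\ 2\mid k}}\phi(k)\,2^{n/k},$$ where $\phi$ is Euler's totient function and the sums run over positive even divisors $k$ of $n$. \end{itemize}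
   Context: For $x=(x_1,\dots,x_n),y=(y_1,\dots,y_n)\in\mathbb{F}_2^n$, $x\cdot y=x_1y_1+\dots+x_ny_n\in\mathbb{F}_2$, and $(-1)^{a}$ for $a\in\mathbb{F}_2$ means $1$ if $a=0$ and $-1$ if $a=1$. Let $\rho_n:\mathbb{F}_2^n\to\mathbb{F}_2^n$ be the cyclic shift $\rho_n(x_1,x_2,\dots,x_n)=(x_2,\dots,x_n,x_1)$ and let $C_n=\langle\rho_n\rangle$, a cyclic group of order $n$ acting on $\mathbb{F}_2^n$. Let $g_n$ be the number of orbits of this action (it is known that $g_n=\frac1n\sum_{k\mid n}\phi(k)2^{n/k}$). In each orbit choose as representative $\Lambda_{n,i}$ the element that is first in lexicographic order, and index the orbits $G_{n,i}$ ($0\le i\le g_n-1$) so that the representatives $\Lambda_{n,0},\dots,\Lambda_{n,g_n-1}$ are in lexicographic order; here $G_{n,i}$ is the orbit of $\Lambda_{n,i}$. The matrix ${}_n\mathcal{A}$ is the $g_n\times g_n$ integer matrix whose $(i,j)$ entry is $\sum_{x\in G_{n,i}}(-1)^{x\cdot\Lambda_{n,j}}$. *)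

theory Defs
  imports
    "HOL-Library.Z2"
    "HOL-Library.List_Lexorder"
    "HOL-Number_Theory.Totient"
    "Jordan_Normal_Form.Char_Poly"
begin

(* F_2^n is represented by the bit lists of length n, x_1 being the head of the list.
   The order 0 < 1 on bit makes the order of List_Lexorder the lexicographic order on F_2^n. *)

instantiation bit :: linorder
begin

definition less_eq_bit :: "bit \<Rightarrow> bit \<Rightarrow> bool" where
  "a \<le> b \<longleftrightarrow> a = 0 \<or> b = 1" for a b :: bit

definition less_bit :: "bit \<Rightarrow> bit \<Rightarrow> bool" where
  "a < b \<longleftrightarrow> a = 0 \<and> b = 1" for a b :: bit

instance
  by standard (auto simp: less_eq_bit_def less_bit_def)

end

definition bitvecs :: "nat \<Rightarrow> bit list set" where
  "bitvecs n = {x. length x = n}"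

definition dot :: "bit list \<Rightarrow> bit list \<Rightarrow> bit" where
  "dot x y = (\<Sum>(a, b)\<leftarrow>zip x y. a * b)"

definition minus_one_pow :: "bit \<Rightarrow> int" where
  "minus_one_pow a = (if a = 0 then 1 else - 1)"

(* rotate1 [x_1, ..., x_n] = [x_2, ..., x_n, x_1] and rotate k is its k-th iterate.
   The shift has finite order, so its natural powers already form the group it generates. *)
definition rot_orbit :: "bit list \<Rightarrow> bit list set" where
  "rot_orbit x = {rotate k x | k. True}"

definition rot_orbits :: "nat \<Rightarrow> bit list set set" where
  "rot_orbits n = rot_orbit ` bitvecs n"

definition num_orbits :: "nat \<Rightarrow> nat" where
  "num_orbits n = card (rot_orbits n)"

definition orbit_reps :: "nat \<Rightarrow> bit list set" where
  "orbit_reps n = Min ` rot_orbits n"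

definition orbit_rep :: "nat \<Rightarrow> nat \<Rightarrow> bit list" where
  "orbit_rep n i = sorted_list_of_set (orbit_reps n) ! i"

definition rs_matrix :: "nat \<Rightarrow> int mat" where
  "rs_matrix n = mat (num_orbits n) (num_orbits n)
     (\<lambda>(i, j). \<Sum>x\<in>rot_orbit (orbit_rep n i). minus_one_pow (dot x (orbit_rep n j)))"

(* Eigenvalues are taken over the complex numbers. *)
definition rs_matrix_complex :: "nat \<Rightarrow> complex mat" where
  "rs_matrix_complex n = map_mat of_int (rs_matrix n)"

definition alg_multiplicity :: "complex mat \<Rightarrow> complex \<Rightarrow> nat" where
  "alg_multiplicity A c = order c (char_poly A)"

end

(* Orthogonality of characters gives A * A = 2^n, so the eigenvalues are r and -r with r = 2^(n/2),
   and their multiplicities are determined by the trace.  Averaging over the cyclic group turns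
   n * tr A into the sum over k < n of T_k, the sum over all x of (-1)^(x . rho^k x).  The
   shift by k splits the positions into d = gcd(n, k) cycles of length m = n/d, so T_k = t_m^d, where
   t_m is the trace of the m-th power of the transfer matrix ((1, 1), (1, -1)), whose eigenvalues are the two square
   roots of 2.  Hence T_k = 2^d r if m is even and 0 otherwise. *)

theory Submission
  imports Defs "Jordan_Normal_Form.Schur_Decomposition"
begin

section \<open>Characters of the space of bit vectors\<close>

lemma minus_one_pow_add: "minus_one_pow (a + b) = minus_one_pow a * minus_one_pow b"
  by (cases a; cases b) (simp_all add: minus_one_pow_def)

lemma minus_one_pow_sum:
  "finite I \<Longrightarrow> minus_one_pow (\<Sum>i\<in>I. f i) = (\<Prod>i\<in>I. minus_one_pow (f i))"
proof (induction I rule: finite_induct)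
  case (insert i I)
  then show ?case
    unfolding sum.insert[OF insert.hyps] prod.insert[OF insert.hyps] minus_one_pow_add by simp
qed (simp add: minus_one_pow_def)

lemma dot_Cons: "dot (a # x) (b # y) = a * b + dot x y"
  by (simp add: dot_def)

lemma minus_one_pow_dot_Cons:
  "minus_one_pow (dot (a # x) (b # y)) = minus_one_pow (a * b) * minus_one_pow (dot x y)"
  by (simp only: dot_Cons minus_one_pow_add)

lemma dot_eq_sum_nth:
  assumes "length x = n" "length y = n"
  shows "dot x y = (\<Sum>i<n. x ! i * y ! i)"
  using assms by (auto simp: dot_def sum_list_sum_nth atLeast0LessThan intro!: sum.cong)

lemma minus_one_pow_dot:
  assumes "length x = n" "length y = n"
  shows "minus_one_pow (dot x y) = (\<Prod>i<n. minus_one_pow (x ! i * y ! i))"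
  by (simp only: dot_eq_sum_nth[OF assms] minus_one_pow_sum finite_lessThan)

lemma bitvecs_0: "bitvecs 0 = {[]}"
  by (auto simp: bitvecs_def)

lemma bitvecs_Suc: "bitvecs (Suc n) = (#) 0 ` bitvecs n \<union> (#) 1 ` bitvecs n"
proof (intro equalityI subsetI)
  fix x assume "x \<in> bitvecs (Suc n)"
  then obtain a y where "x = a # y" "length y = n"
    by (auto simp: bitvecs_def length_Suc_conv)
  then show "x \<in> (#) 0 ` bitvecs n \<union> (#) 1 ` bitvecs n"
    by (cases a) (auto simp: bitvecs_def)
qed (auto simp: bitvecs_def)

lemma finite_bitvecs [simp]: "finite (bitvecs n)"
  by (induction n) (simp_all add: bitvecs_0 bitvecs_Suc)

lemma sum_bitvecs_Suc:
  fixes f :: "bit list \<Rightarrow> 'a :: comm_monoid_add"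
  shows "(\<Sum>x\<in>bitvecs (Suc n). f x) = (\<Sum>x\<in>bitvecs n. f (0 # x)) + (\<Sum>x\<in>bitvecs n. f (1 # x))"
proof -
  have "(\<Sum>x\<in>bitvecs (Suc n). f x) = sum f ((#) 0 ` bitvecs n) + sum f ((#) 1 ` bitvecs n)"
    unfolding bitvecs_Suc by (intro sum.union_disjoint) auto
  then show ?thesis
    by (simp add: sum.reindex o_def)
qed

text \<open>Splitting off the first bit of \<open>y\<close> leaves the factor
  \<open>1 + minus_one_pow a * minus_one_pow c\<close>, with \<open>a\<close> and \<open>c\<close>
  the first bits of \<open>x\<close> and \<open>z\<close>: it is 2 if they agree and 0
  otherwise.\<close>

lemma character_orthogonality:
  assumes "length x = n" "length z = n"
  shows "(\<Sum>y\<in>bitvecs n. minus_one_pow (dot x y) * minus_one_pow (dot y z)) = (if x = z then 2 ^ n else 0)"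
  using assms
proof (induction n arbitrary: x z)
  case 0
  then show ?case by (simp add: bitvecs_0 dot_def minus_one_pow_def)
next
  case (Suc n)
  obtain a x' c z' where *: "x = a # x'" "z = c # z'" "length x' = n" "length z' = n"
    using Suc.prems by (auto simp: length_Suc_conv)
  let ?S = "\<Sum>y\<in>bitvecs n. minus_one_pow (dot x' y) * minus_one_pow (dot y z')"
  have "(\<Sum>y\<in>bitvecs (Suc n). minus_one_pow (dot x y) * minus_one_pow (dot y z))
      = ?S + minus_one_pow a * minus_one_pow c * ?S"
    by (simp add: * sum_bitvecs_Suc minus_one_pow_dot_Cons minus_one_pow_def[of 0]
        sum_distrib_left mult_ac)
  also have "\<dots> = (if x = z then 2 ^ Suc n else 0)"
    unfolding Suc.IH[OF *(3,4)] * by (cases a; cases c) (simp_all add: minus_one_pow_def)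
  finally show ?case .
qed

text \<open>The last product is written in front, as in \<open>dot_Cons\<close>, so that invariance
  under \<open>rotate1\<close> is a matter of rewriting.\<close>

lemma dot_snoc:
  assumes "length x = length y"
  shows "dot (x @ [a]) (y @ [b]) = a * b + dot x y"
  unfolding dot_def zip_append[OF assms] map_append sum_list_append
  by (subst add.commute) simp

lemma dot_rotate1: "length x = length y \<Longrightarrow> dot (rotate1 x) (rotate1 y) = dot x y"
  by (cases x; cases y) (simp_all only: rotate1.simps dot_Cons dot_snoc length_Cons nat.inject list.size nat.distinct)

lemma dot_rotate: "length x = length y \<Longrightarrow> dot (rotate k x) (rotate k y) = dot x y"
  by (induction k) (simp_all add: dot_rotate1)

section \<open>Orbits of the cyclic shift\<close>

lemma self_in_rot_orbit: "x \<in> rot_orbit x"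
  unfolding rot_orbit_def by (auto intro: exI[of _ 0])

lemma length_rot_orbit: "y \<in> rot_orbit x \<Longrightarrow> length y = length x"
  by (auto simp: rot_orbit_def)

lemma finite_rot_orbit [simp]: "finite (rot_orbit x)"
  by (rule finite_subset[OF _ finite_bitvecs[of "length x"]])
    (auto simp: bitvecs_def dest: length_rot_orbit)

text \<open>The inverse is again a natural power: \<open>k * length x\<close> is a multiple of the
  period and at least \<open>k\<close> when \<open>x\<close> is nonempty. For the empty list the
  subtraction would be truncated, but every rotation fixes it.\<close>

lemma rotate_back: "\<exists>j. rotate j (rotate k x) = x"
proof -
  have "k * length x - k + k = k * length x" if "x \<noteq> []"
    using that by (cases x) simp_all
  then have "rotate (k * length x - k) (rotate k x) = x" if "x \<noteq> []"
    using that by (simp only: rotate_rotate) simp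
  then show ?thesis
    by (cases "x = []") auto
qed

lemma rot_orbit_eqI:
  assumes "y \<in> rot_orbit x"
  shows "rot_orbit y = rot_orbit x"
proof -
  obtain k where k: "y = rotate k x"
    using assms by (auto simp: rot_orbit_def)
  obtain j where j: "x = rotate j y"
    using rotate_back k by metis
  show ?thesis
  proof (intro equalityI subsetI)
    fix z assume "z \<in> rot_orbit y"
    then show "z \<in> rot_orbit x"
      by (auto simp: rot_orbit_def k rotate_rotate)
  next
    fix z assume "z \<in> rot_orbit x"
    then show "z \<in> rot_orbit y"
      by (subst (asm) j) (auto simp: rot_orbit_def rotate_rotate)
  qed
qed

lemma inj_rotate: "inj (rotate k)"
  unfolding rotate_def by (intro inj_fn inj_rotate1)

lemma sum_rot_orbit_rotate:
  "(\<Sum>y\<in>rot_orbit x. f (rotate k y)) = (\<Sum>y\<in>rot_orbit x. f y)"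
proof -
  have "rotate k ` rot_orbit x \<subseteq> rot_orbit x"
    by (auto simp: rot_orbit_def rotate_rotate)
  then have "rotate k ` rot_orbit x = rot_orbit x"
    by (intro endo_inj_surj) (auto intro: inj_on_subset[OF inj_rotate])
  then show ?thesis
    using sum.reindex[OF inj_on_subset[OF inj_rotate subset_UNIV], of f k "rot_orbit x"]
    by (simp add: o_def)
qed

text \<open>The summand is \<open>n\<close>-periodic in \<open>k\<close>, so moving the window of
  summation by one trades a term for an equal one. Comparing the two windows cancels that term,
  hence the type class.\<close>

lemma sum_rotate_shift:
  fixes f :: "bit list \<Rightarrow> 'a :: cancel_comm_monoid_add"
  assumes "length x = n"
  shows "(\<Sum>k<n. f (rotate k (rotate j x))) = (\<Sum>k<n. f (rotate k x))"
proof (induction j)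
  case (Suc j)
  let ?h = "\<lambda>k. f (rotate (k + j) x)"
  have "?h n = ?h 0"
    using assms by (simp add: rotate_rotate[symmetric])
  moreover have "(\<Sum>k<n. ?h k) + ?h n = ?h 0 + (\<Sum>k<n. ?h (Suc k))"
    using sum.lessThan_Suc[of ?h n] sum.lessThan_Suc_shift[of ?h n] by (simp only:)
  ultimately have "(\<Sum>k<n. ?h (Suc k)) = (\<Sum>k<n. ?h k)"
    by (simp add: add.commute)
  with Suc show ?case
    by (simp add: rotate_rotate del: rotate_Suc)
qed simp

text \<open>Averaging both arguments of an invariant kernel over the group: no stabilizer is needed.\<close>

lemma sum_rot_orbit_kernel:
  fixes F :: "bit list \<Rightarrow> bit list \<Rightarrow> int"
  assumes inv: "\<And>k y. length y = n \<Longrightarrow> F (rotate k y) (rotate k x) = F y x"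
    and x: "length x = n"
  shows "int n * (\<Sum>y\<in>rot_orbit x. F y x) = (\<Sum>y\<in>rot_orbit x. \<Sum>k<n. F y (rotate k y))"
proof -
  have "int n * (\<Sum>y\<in>rot_orbit x. F y x) = (\<Sum>k<n. \<Sum>y\<in>rot_orbit x. F (rotate k y) (rotate k x))"
    using inv x by (simp add: length_rot_orbit)
  also have "\<dots> = (\<Sum>y\<in>rot_orbit x. \<Sum>k<n. F y (rotate k x))"
    unfolding sum_rot_orbit_rotate[where f = "\<lambda>y. F y (rotate k x)" for k] by (rule sum.swap)
  \<comment> \<open>As \<open>y\<close> is itself a shift of \<open>x\<close>, a full period of
    shifts of \<open>x\<close> and one of \<open>y\<close> give the same sum.\<close>
  also have "\<dots> = (\<Sum>y\<in>rot_orbit x. \<Sum>k<n. F y (rotate k y))"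
  proof (rule sum.cong[OF refl])
    fix y assume "y \<in> rot_orbit x"
    then obtain j where "y = rotate j x"
      by (auto simp: rot_orbit_def)
    then show "(\<Sum>k<n. F y (rotate k x)) = (\<Sum>k<n. F y (rotate k y))"
      using sum_rotate_shift[OF x, of "F y" j] by simp
  qed
  finally show ?thesis .
qed

lemma finite_rot_orbits [simp]: "finite (rot_orbits n)"
  by (simp add: rot_orbits_def)

lemma rot_orbits_disjoint:
  assumes "G \<in> rot_orbits n" "H \<in> rot_orbits n" "x \<in> G" "x \<in> H"
  shows "G = H"
proof -
  obtain y z where "G = rot_orbit y" "H = rot_orbit z"
    using assms by (auto simp: rot_orbits_def)
  then show ?thesis
    using assms rot_orbit_eqI by metis
qed

lemma sum_bitvecs_orbits: "(\<Sum>x\<in>bitvecs n. f x) = (\<Sum>G\<in>rot_orbits n. \<Sum>x\<in>G. f x)"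
proof -
  have "bitvecs n = \<Union> (rot_orbits n)"
    using self_in_rot_orbit by (auto simp: rot_orbits_def bitvecs_def dest: length_rot_orbit)
  moreover have "\<forall>G\<in>rot_orbits n. finite G"
    by (auto simp: rot_orbits_def)
  moreover have "\<forall>G\<in>rot_orbits n. \<forall>H\<in>rot_orbits n. G \<noteq> H \<longrightarrow> G \<inter> H = {}"
    using rot_orbits_disjoint by blast
  ultimately have "sum f (bitvecs n) = (sum \<circ> sum) f (rot_orbits n)"
    using sum.Union_disjoint by metis
  then show ?thesis by simp
qed

lemma Min_rot_orbit:
  assumes "G \<in> rot_orbits n"
  shows "Min G \<in> G" "rot_orbit (Min G) = G"
proof -
  obtain x where G: "G = rot_orbit x"
    using assms by (auto simp: rot_orbits_def)
  show "Min G \<in> G"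
    unfolding G using self_in_rot_orbit by (intro Min_in) auto
  then show "rot_orbit (Min G) = G"
    unfolding G by (rule rot_orbit_eqI)
qed

text \<open>An orbit is recovered from its minimum, so \<open>Min\<close> is injective on orbits and
  the sorted list of representatives has one entry for each orbit.\<close>

lemma bij_betw_orbit_rep:
  "bij_betw (\<lambda>i. rot_orbit (orbit_rep n i)) {..<num_orbits n} (rot_orbits n)"
proof -
  have inj: "inj_on Min (rot_orbits n)"
    by (metis Min_rot_orbit(2) inj_onI)
  have "bij_betw (orbit_rep n) {..<num_orbits n} (orbit_reps n)"
    unfolding orbit_rep_def
    by (rule bij_betw_nth) (simp_all add: orbit_reps_def num_orbits_def card_image inj)
  moreover have "bij_betw rot_orbit (orbit_reps n) (rot_orbits n)"
    unfolding orbit_reps_def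
    by (rule bij_betw_byWitness[where f' = Min]) (auto simp: Min_rot_orbit(2))
  ultimately show ?thesis
    using bij_betw_trans by (fastforce simp: o_def)
qed

lemma length_orbit_rep:
  assumes "i < num_orbits n"
  shows "length (orbit_rep n i) = n"
proof -
  have "rot_orbit (orbit_rep n i) \<in> rot_orbits n"
    using bij_betwE[OF bij_betw_orbit_rep] assms by blast
  then obtain x where "length x = n" "rot_orbit (orbit_rep n i) = rot_orbit x"
    by (auto simp: rot_orbits_def bitvecs_def)
  then show ?thesis
    using self_in_rot_orbit[of "orbit_rep n i"] length_rot_orbit by metis
qed

lemma orbit_rep_in_orbit_iff:
  assumes "i < num_orbits n" "j < num_orbits n"
  shows "orbit_rep n j \<in> rot_orbit (orbit_rep n i) \<longleftrightarrow> i = j"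
proof
  assume "orbit_rep n j \<in> rot_orbit (orbit_rep n i)"
  then have "rot_orbit (orbit_rep n i) = rot_orbit (orbit_rep n j)"
    by (rule rot_orbit_eqI[symmetric])
  then show "i = j"
    using assms inj_onD[OF bij_betw_imp_inj_on[OF bij_betw_orbit_rep[of n]]] by simp
qed (simp add: self_in_rot_orbit)

lemma sum_bitvecs_orbit_rep:
  "(\<Sum>x\<in>bitvecs n. f x) = (\<Sum>i<num_orbits n. \<Sum>x\<in>rot_orbit (orbit_rep n i). f x)"
  unfolding sum_bitvecs_orbits
  by (rule sum.reindex_bij_betw[OF bij_betw_orbit_rep, symmetric])

section \<open>The square of the matrix\<close>

text \<open>For a fixed row, the orbit sum of characters is constant on orbits as a function of
  \<open>y\<close>. The sum over representatives therefore spreads out to all of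
  \<open>bitvecs n\<close>, where orthogonality applies.\<close>

lemma rs_matrix_square:
  "rs_matrix n * rs_matrix n = 2 ^ n \<cdot>\<^sub>m 1\<^sub>m (num_orbits n)"
\<comment> \<open>The two dimension goals are closed here; \<open>fail\<close> undoes a partial
  simplification of the entry goal.\<close>
proof (rule eq_matI; (simp add: rs_matrix_def; fail)?)
  fix i l assume "i < dim_row (2 ^ n \<cdot>\<^sub>m 1\<^sub>m (num_orbits n) :: int mat)"
    "l < dim_col (2 ^ n \<cdot>\<^sub>m 1\<^sub>m (num_orbits n) :: int mat)"
  then have il: "i < num_orbits n" "l < num_orbits n"
    by simp_all
  let ?L = "orbit_rep n" and ?O = "\<lambda>i. rot_orbit (orbit_rep n i)"
  define f where "f y = (\<Sum>x\<in>?O i. minus_one_pow (dot x y))" for y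
  have f_inv: "f (rotate k y) = f y" if "length y = n" for k y
  proof -
    have "f (rotate k y) = (\<Sum>x\<in>?O i. minus_one_pow (dot (rotate k x) (rotate k y)))"
      unfolding f_def by (rule sum_rot_orbit_rotate[symmetric])
    also have "\<dots> = f y"
      unfolding f_def using that il length_orbit_rep
      by (intro sum.cong refl) (simp add: dot_rotate length_rot_orbit)
    finally show ?thesis .
  qed
  have "(rs_matrix n * rs_matrix n) $$ (i, l)
      = (\<Sum>j<num_orbits n. f (?L j) * (\<Sum>y\<in>?O j. minus_one_pow (dot y (?L l))))"
    using il by (simp add: rs_matrix_def scalar_prod_def f_def atLeast0LessThan)
  also have "\<dots> = (\<Sum>j<num_orbits n. \<Sum>y\<in>?O j. f y * minus_one_pow (dot y (?L l)))"
    unfolding sum_distrib_left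
  proof (intro sum.cong refl)
    fix j y assume "j \<in> {..<num_orbits n}" "y \<in> ?O j"
    then have "f y = f (?L j)"
      using f_inv length_orbit_rep by (auto simp: rot_orbit_def)
    then show "f (?L j) * minus_one_pow (dot y (?L l)) = f y * minus_one_pow (dot y (?L l))"
      by simp
  qed
  also have "\<dots> = (\<Sum>y\<in>bitvecs n. f y * minus_one_pow (dot y (?L l)))"
    by (rule sum_bitvecs_orbit_rep[symmetric])
  also have "\<dots> = (\<Sum>x\<in>?O i. \<Sum>y\<in>bitvecs n. minus_one_pow (dot x y) * minus_one_pow (dot y (?L l)))"
    unfolding f_def sum_distrib_right by (rule sum.swap)
  also have "\<dots> = (\<Sum>x\<in>?O i. if x = ?L l then 2 ^ n else 0)"
    using il length_orbit_rep length_rot_orbit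
    by (intro sum.cong refl character_orthogonality) auto
  \<comment> \<open>The sum sees \<open>2 ^ n\<close> exactly when the representative
    \<open>?L l\<close> lies in orbit \<open>i\<close>, that is when \<open>i = l\<close>.\<close>
  also have "\<dots> = (2 ^ n \<cdot>\<^sub>m 1\<^sub>m (num_orbits n)) $$ (i, l)"
    using il by (simp add: orbit_rep_in_orbit_iff)
  finally show "(rs_matrix n * rs_matrix n) $$ (i, l) = (2 ^ n \<cdot>\<^sub>m 1\<^sub>m (num_orbits n)) $$ (i, l)" .
qed

section \<open>The trace of the matrix\<close>

text \<open>The number T_k; for \<open>k = 1\<close> and \<open>n > 0\<close> it is the trace of the
  \<open>n\<close>-th power of the transfer matrix.\<close>

definition autocorrelation_sum :: "nat \<Rightarrow> nat \<Rightarrow> int" where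
  "autocorrelation_sum n k = (\<Sum>x\<in>bitvecs n. minus_one_pow (dot x (rotate k x)))"

text \<open>The kernel (-1)^(x . y) is invariant under simultaneous shifts, so averaging turns
  \<open>n\<close> times each diagonal entry into a sum over its orbit, and the orbits fill
  \<open>bitvecs n\<close>.\<close>

lemma rs_matrix_trace:
  "int n * (\<Sum>i<num_orbits n. rs_matrix n $$ (i, i)) = (\<Sum>k<n. autocorrelation_sum n k)"
proof -
  let ?O = "\<lambda>i. rot_orbit (orbit_rep n i)"
  have "int n * (\<Sum>i<num_orbits n. rs_matrix n $$ (i, i))
      = (\<Sum>i<num_orbits n. int n * (\<Sum>x\<in>?O i. minus_one_pow (dot x (orbit_rep n i))))"
    by (simp add: rs_matrix_def sum_distrib_left)
  also have "\<dots> = (\<Sum>i<num_orbits n. \<Sum>x\<in>?O i. \<Sum>k<n. minus_one_pow (dot x (rotate k x)))"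
    by (intro sum.cong refl sum_rot_orbit_kernel) (simp_all add: dot_rotate length_orbit_rep)
  also have "\<dots> = (\<Sum>k<n. autocorrelation_sum n k)"
    unfolding sum_bitvecs_orbit_rep[symmetric] autocorrelation_sum_def by (rule sum.swap)
  finally show ?thesis .
qed

section \<open>The shift by one and the transfer matrix\<close>

text \<open>\<open>path_sum m\<close> is the power \<open>m + 1\<close> of the transfer matrix ((1, 1), (1, -1)), whose square is
  twice the identity.\<close>

definition path_sum :: "nat \<Rightarrow> bit \<Rightarrow> bit \<Rightarrow> int" where
  "path_sum m a b = (\<Sum>y\<in>bitvecs m. minus_one_pow (dot (a # y) (y @ [b])))"

lemma path_sum_0: "path_sum 0 a b = minus_one_pow (a * b)"
  by (simp add: path_sum_def bitvecs_0 dot_def)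

text \<open>Splitting on the first inner bit is left multiplication by the transfer matrix, whose
  row \<open>a\<close> is (1, (-1)^a).\<close>

lemma path_sum_Suc: "path_sum (Suc m) a b = path_sum m 0 b + minus_one_pow a * path_sum m 1 b"
  by (simp add: path_sum_def sum_bitvecs_Suc minus_one_pow_dot_Cons minus_one_pow_def[of 0]
      sum_distrib_left)

lemma path_sum_Suc_Suc: "path_sum (Suc (Suc m)) a b = 2 * path_sum m a b"
  by (cases a) (simp_all add: path_sum_Suc minus_one_pow_def)

text \<open>Rotating \<open>a # y\<close> gives \<open>y @ [a]\<close>, so the path closes up and
  the sum over \<open>a\<close> is a trace.\<close>

lemma autocorrelation_sum_Suc_1: "autocorrelation_sum (Suc m) 1 = path_sum m 0 0 + path_sum m 1 1"
  by (simp add: autocorrelation_sum_def sum_bitvecs_Suc path_sum_def)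

text \<open>Two more steps double the trace, which is 0 for length 1 and 4 for length 2. Length 0 is
  excluded: the sum over the empty vector is 1, while the identity has trace 2.\<close>

lemma autocorrelation_sum_1:
  assumes "m > 0"
  shows "autocorrelation_sum m 1 = (if even m then 2 * 2 ^ (m div 2) else 0)"
proof -
  \<comment> \<open>With length \<open>Suc l\<close> the parity condition is reversed: even
    \<open>l\<close> means odd length.\<close>
  have "autocorrelation_sum (Suc l) 1 = (if even l then 0 else 2 * 2 ^ (Suc l div 2))" for l
  proof (induction l rule: induct_nat_012)
    case (ge2 l)
    have "autocorrelation_sum (Suc (Suc (Suc l))) 1 = 2 * autocorrelation_sum (Suc l) 1"
      unfolding autocorrelation_sum_Suc_1 path_sum_Suc_Suc by simp
    then show ?case
      using ge2.IH(1) by simp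
  qed (simp_all only: autocorrelation_sum_Suc_1 path_sum_Suc path_sum_0, simp_all add: minus_one_pow_def)
  from this[of "m - 1"] assms show ?thesis
    by (cases m) auto
qed

section \<open>Cycles of the shift by k\<close>

text \<open>The cycles of i -> i + k modulo \<open>n\<close> are the cosets of the subgroup
  generated by \<open>k\<close>, which has index \<open>d\<close> and order \<open>m\<close>;
  \<open>c\<close> names the coset and \<open>j\<close> the place along the cycle.\<close>

lemma bij_betw_shift_cycles:
  fixes n k :: nat
  assumes n: "n > 0" and d: "d = gcd n k" and m: "m = n div d"
  shows "bij_betw (\<lambda>(c, j). (c + j * k) mod n) ({..<d} \<times> {..<m}) {..<n}"
proof -
  have "d > 0" "d dvd n"
    using n by (simp_all add: d)
  then have nm: "n = d * m"
    by (simp add: m)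
  have "d dvd k"
    by (simp add: d)
  then obtain q where k: "k = d * q" ..
  have "coprime (n div d) (k div d)"
    unfolding d using n by (intro div_gcd_coprime) simp
  then have coprime: "coprime q m"
    using \<open>d > 0\<close> by (simp add: k m coprime_commute)
  have inj: "inj_on (\<lambda>(c, j). (c + j * k) mod n) ({..<d} \<times> {..<m})"
  proof (rule inj_onI, clarsimp)
    fix c j c' j' :: nat
    assume *: "c < d" "j < m" "c' < d" "j' < m" and eq: "(c + j * k) mod n = (c' + j' * k) mod n"
    from eq have cong: "[c + j * k = c' + j' * k] (mod n)"
      by (simp add: cong_def)
    \<comment> \<open>Modulo \<open>d\<close> the multiples of \<open>k\<close> vanish, which
      isolates \<open>c\<close>.\<close>
    then have "[c + j * k = c' + j' * k] (mod d)"
      using \<open>d dvd n\<close> by (rule cong_dvd_modulus_nat)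
    moreover have "(c + j * k) mod d = c" "(c' + j' * k) mod d = c'"
      using * by (simp_all add: k mult.left_commute[of _ d])
    ultimately have c: "c = c'"
      by (simp add: cong_def)
    with cong have "[j * k = j' * k] (mod n)"
      by (simp add: cong_add_lcancel_nat)
    then have "[d * (j * q) = d * (j' * q)] (mod d * m)"
      unfolding nm k by (simp only: mult.left_commute[of _ d])
    then have "[j * q = j' * q] (mod m)"
      using \<open>d > 0\<close> by (simp add: cong_def mod_mult_mult1)
    \<comment> \<open>After division by \<open>d\<close> the modulus is \<open>m\<close>, where
      \<open>q = k / d\<close> is invertible.\<close>
    then have "[j = j'] (mod m)"
      by (simp only: cong_mult_rcancel_nat[OF coprime])
    then show "c = c' \<and> j = j'"
      using * c by (simp add: cong_def)
  qed
  moreover have "(\<lambda>(c, j). (c + j * k) mod n) ` ({..<d} \<times> {..<m}) = {..<n}"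
  proof (rule card_subset_eq)
    show "card ((\<lambda>(c, j). (c + j * k) mod n) ` ({..<d} \<times> {..<m})) = card {..<n}"
      by (simp add: card_image[OF inj] nm[symmetric])
  qed (use n in auto)
  ultimately show ?thesis
    by (simp add: bij_betw_def)
qed

lemma card_bitvecs: "card (bitvecs n) = 2 ^ n"
  using sum_bitvecs_Suc[of "\<lambda>_. 1 :: nat"] by (induction n) (simp_all add: bitvecs_0)

text \<open>Reading \<open>x\<close> along the \<open>d\<close> cycles turns the shift by
  \<open>k\<close> into a shift by one of each cycle. The summand becomes a product over independent
  cycles, and the sum a \<open>d\<close>-th power.\<close>

lemma autocorrelation_sum_power:
  fixes n k :: nat
  assumes n: "n > 0" and d: "d = gcd n k" and m: "m = n div d"
  shows "autocorrelation_sum n k = autocorrelation_sum m 1 ^ d"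
proof -
  let ?pos = "\<lambda>c j. (c + j * k) mod n"
  \<comment> \<open>Restriction to \<open>{..<d}\<close> fixes the value elsewhere, so that the
    families of cycles form a \<open>PiE\<close> set.\<close>
  define cycles where
    "cycles x = (\<lambda>c\<in>{..<d}. map (\<lambda>j. x ! ?pos c j) [0..<m])" for x :: "bit list"
  note bij = bij_betw_shift_cycles[OF n d m]
  have nm: "n = d * m"
    by (simp add: d m)
  with n have mpos: "m > 0"
    by (auto intro: gr0I)
  have "d dvd k"
    by (simp add: d)
  then have mk: "(m * k) mod n = 0"
    by (auto simp: nm mult.left_commute[of m d])
  \<comment> \<open>The last place of a cycle is followed by its first, because \<open>m * k\<close>
    is a multiple of \<open>n\<close>.\<close>
  have pos_Suc: "?pos c (Suc j mod m) = (?pos c j + k) mod n" if "j < m" for c j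
  proof (cases "Suc j = m")
    case True
    have "(?pos c j + k) mod n = (c + (j * k + k)) mod n"
      by (simp add: mod_add_left_eq add.assoc)
    also have "j * k + k = m * k"
      using True by auto
    also have "(c + m * k) mod n = c mod n"
      using mk by (metis add.right_neutral mod_add_right_eq)
    finally show ?thesis
      using True by simp
  next
    case False
    then show ?thesis
      using that by (simp add: mod_add_left_eq add.assoc) (simp only: add.commute[of k])
  qed
  have cycles_prod: "minus_one_pow (dot x (rotate k x))
      = (\<Prod>c<d. minus_one_pow (dot (cycles x c) (rotate 1 (cycles x c))))" if "length x = n" for x
  proof -
    have "minus_one_pow (dot x (rotate k x))
        = (\<Prod>i<n. minus_one_pow (x ! i * x ! ((i + k) mod n)))"
      using that by (simp add: minus_one_pow_dot[of x n] nth_rotate add.commute)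
    also have "\<dots> = (\<Prod>(c, j)\<in>{..<d} \<times> {..<m}. minus_one_pow (x ! ?pos c j * x ! ((?pos c j + k) mod n)))"
      by (subst prod.reindex_bij_betw[OF bij, symmetric]) (simp add: case_prod_unfold)
    also have "\<dots> = (\<Prod>c<d. \<Prod>j<m. minus_one_pow (x ! ?pos c j * x ! ((?pos c j + k) mod n)))"
      by (rule prod.cartesian_product[symmetric])
    also have "\<dots> = (\<Prod>c<d. minus_one_pow (dot (cycles x c) (rotate 1 (cycles x c))))"
    proof (intro prod.cong refl)
      fix c assume "c \<in> {..<d}"
      have "minus_one_pow (dot (cycles x c) (rotate 1 (cycles x c)))
          = (\<Prod>j<m. minus_one_pow (cycles x c ! j * rotate 1 (cycles x c) ! j))"
        using \<open>c \<in> {..<d}\<close> by (intro minus_one_pow_dot) (simp_all add: cycles_def)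
      also have "\<dots> = (\<Prod>j<m. minus_one_pow (x ! ?pos c j * x ! ((?pos c j + k) mod n)))"
      proof (intro prod.cong refl)
        fix j assume "j \<in> {..<m}"
        then have "rotate 1 (cycles x c) ! j = x ! ?pos c (Suc j mod m)"
          using \<open>c \<in> {..<d}\<close> mpos by (subst nth_rotate) (simp_all add: cycles_def)
        then show "minus_one_pow (cycles x c ! j * rotate 1 (cycles x c) ! j)
            = minus_one_pow (x ! ?pos c j * x ! ((?pos c j + k) mod n))"
          using \<open>c \<in> {..<d}\<close> \<open>j \<in> {..<m}\<close> pos_Suc[of j c] by (simp add: cycles_def)
      qed
      finally show "(\<Prod>j<m. minus_one_pow (x ! ?pos c j * x ! ((?pos c j + k) mod n)))
          = minus_one_pow (dot (cycles x c) (rotate 1 (cycles x c)))" ..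
    qed
    finally show ?thesis .
  qed
  have inj: "inj_on cycles (bitvecs n)"
  proof (rule inj_onI)
    fix x y assume xy: "x \<in> bitvecs n" "y \<in> bitvecs n" "cycles x = cycles y"
    show "x = y"
    proof (rule nth_equalityI)
      fix i assume "i < length x"
      then have "i \<in> (\<lambda>(c, j). ?pos c j) ` ({..<d} \<times> {..<m})"
        using xy bij_betw_imp_surj_on[OF bij] by (simp add: bitvecs_def)
      then obtain c j where cj: "c < d" "j < m" "i = ?pos c j"
        by auto
      have "cycles x c ! j = cycles y c ! j"
        using xy by simp
      then show "x ! i = y ! i"
        using cj by (simp add: cycles_def)
    qed (use xy in \<open>simp add: bitvecs_def\<close>)
  qed
  \<comment> \<open>Surjectivity by counting: both sides have \<open>2 ^ n = (2 ^ m) ^ d\<close>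
    elements.\<close>
  have "cycles ` bitvecs n = ({..<d} \<rightarrow>\<^sub>E bitvecs m)"
  proof (rule card_subset_eq)
    show "card (cycles ` bitvecs n) = card ({..<d} \<rightarrow>\<^sub>E bitvecs m)"
      unfolding card_image[OF inj] card_bitvecs
      by (simp add: card_PiE card_bitvecs nm power_mult[symmetric] mult.commute)
    show "cycles ` bitvecs n \<subseteq> {..<d} \<rightarrow>\<^sub>E bitvecs m"
      by (auto simp: cycles_def bitvecs_def[of m] split: if_splits)
  qed (intro finite_PiE, simp_all)
  with inj have bij_cycles: "bij_betw cycles (bitvecs n) ({..<d} \<rightarrow>\<^sub>E bitvecs m)"
    by (simp add: bij_betw_def)
  have "autocorrelation_sum n k
      = (\<Sum>x\<in>bitvecs n. \<Prod>c<d. minus_one_pow (dot (cycles x c) (rotate 1 (cycles x c))))"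
    unfolding autocorrelation_sum_def
    by (intro sum.cong refl cycles_prod) (simp add: bitvecs_def)
  also have "\<dots> = (\<Sum>z\<in>{..<d} \<rightarrow>\<^sub>E bitvecs m. \<Prod>c<d. minus_one_pow (dot (z c) (rotate 1 (z c))))"
    by (rule sum.reindex_bij_betw[OF bij_cycles])
  also have "\<dots> = autocorrelation_sum m 1 ^ d"
    unfolding autocorrelation_sum_def by (subst prod_sum_PiE[symmetric]) simp_all
  finally show ?thesis .
qed

text \<open>For even \<open>m = n div d\<close> the power is \<open>(2 * 2 ^ (m div 2)) ^ d\<close>,
  and \<open>(m div 2) * d = n div 2\<close>; for odd \<open>m\<close> it is \<open>0 ^ d\<close>
  with \<open>d > 0\<close>.\<close>

lemma autocorrelation_sum_eq:
  fixes n k :: nat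
  assumes "n > 0"
  shows "autocorrelation_sum n k
    = (if even (n div gcd n k) then 2 ^ gcd n k * 2 ^ (n div 2) else 0)"
proof -
  let ?d = "gcd n k" and ?m = "n div gcd n k"
  have dm: "?d * ?m = n"
    by simp
  then have "?m > 0"
    using assms by (metis gr0I mult_0_right)
  moreover have "?m div 2 * ?d = n div 2" if "even ?m"
    using that dm div_mult_swap[OF that, of ?d] by (simp only: mult.commute)
  ultimately show ?thesis
    unfolding autocorrelation_sum_power[OF assms refl refl] autocorrelation_sum_1[OF \<open>?m > 0\<close>]
    using assms by (simp add: power_mult_distrib power_mult[symmetric])
qed

text \<open>Shifts are grouped by their gcd \<open>d\<close> with \<open>n\<close>; there are
  \<open>totient (n div d)\<close> of them. Then \<open>k = n div d\<close>, the order of the shift,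
  becomes the index.\<close>

lemma sum_autocorrelation_sum:
  assumes "n > 0"
  shows "(\<Sum>k<n. autocorrelation_sum n k)
    = 2 ^ (n div 2) * (\<Sum>k | k dvd n \<and> even k. int (totient k) * 2 ^ (n div k))"
proof -
  have div_div: "n div (n div k) = k" if "k dvd n" for k
    using assms that by (auto elim!: dvdE)
  let ?t = "\<lambda>d. if even (n div d) then 2 ^ d * 2 ^ (n div 2) else 0 :: int"
  have "(\<Sum>k<n. autocorrelation_sum n k) = (\<Sum>k<n. ?t (gcd n k))"
    using assms by (simp add: autocorrelation_sum_eq)
  \<comment> \<open>The shift 0 is renamed \<open>n\<close>, which has the same gcd with
    \<open>n\<close>, to reach the range used by \<open>card_gcd_eq_totient\<close>.\<close>
  also have "\<dots> = (\<Sum>k\<in>{0<..n}. ?t (gcd k n))"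
    by (rule sum.reindex_bij_witness[where i = "\<lambda>k. if k = n then 0 else k"
          and j = "\<lambda>k. if k = 0 then n else k"])
      (use assms in \<open>auto simp: gcd.commute\<close>)
  also have "\<dots> = (\<Sum>d | d dvd n. \<Sum>k | k \<in> {0<..n} \<and> gcd k n = d. ?t (gcd k n))"
    using assms by (intro sum.group[symmetric]) auto
  also have "\<dots> = (\<Sum>d | d dvd n. int (totient (n div d)) * ?t d)"
    using assms by (intro sum.cong refl) (simp add: card_gcd_eq_totient[of n, symmetric])
  also have "\<dots> = (\<Sum>k | k dvd n. int (totient k) * ?t (n div k))"
    by (rule sum.reindex_bij_witness[where i = "\<lambda>k. n div k" and j = "\<lambda>k. n div k"])
      (use assms in \<open>auto simp: div_div\<close>)
  also have "\<dots> = (\<Sum>k | k dvd n \<and> even k. int (totient k) * ?t (n div k))"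
    using assms by (intro sum.mono_neutral_right) (auto simp: div_div)
  also have "\<dots> = (\<Sum>k | k dvd n \<and> even k. 2 ^ (n div 2) * (int (totient k) * 2 ^ (n div k)))"
    using assms by (intro sum.cong refl) (auto simp: div_div)
  finally show ?thesis
    by (simp add: sum_distrib_left)
qed

section \<open>Eigenvalues of a matrix with scalar square\<close>

lemma trace_mult_commute:
  fixes X Y :: "'a :: comm_semiring_0 mat"
  assumes "X \<in> carrier_mat n n" "Y \<in> carrier_mat n n"
  shows "(\<Sum>i<n. (X * Y) $$ (i, i)) = (\<Sum>i<n. (Y * X) $$ (i, i))"
proof -
  have "(\<Sum>i<n. (X * Y) $$ (i, i)) = (\<Sum>i<n. \<Sum>j<n. X $$ (i, j) * Y $$ (j, i))"
    using assms by (simp add: scalar_prod_def atLeast0LessThan)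
  also have "\<dots> = (\<Sum>j<n. \<Sum>i<n. X $$ (i, j) * Y $$ (j, i))"
    by (rule sum.swap)
  also have "\<dots> = (\<Sum>i<n. (Y * X) $$ (i, i))"
    using assms by (simp add: scalar_prod_def atLeast0LessThan mult.commute)
  finally show ?thesis .
qed

text \<open>A Schur decomposition conjugates \<open>A\<close> to a triangular matrix with diagonal
  \<open>es\<close>, and conjugation preserves the trace.\<close>

lemma sum_list_eigenvalues_eq_trace:
  fixes A :: "complex mat"
  assumes A: "A \<in> carrier_mat n n" and es: "char_poly A = (\<Prod>e\<leftarrow>es. [:- e, 1:])"
  shows "sum_list es = (\<Sum>i<n. A $$ (i, i))"
proof -
  obtain B P Q where "schur_decomposition A es = (B, P, Q)"
    by (cases "schur_decomposition A es") auto
  from schur_decomposition[OF A es this]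
  have sim: "similar_mat_wit A B P Q" and diag: "diag_mat B = es"
    by simp_all
  note PQ = similar_mat_witD2[OF A sim]
  have "(\<Sum>i<n. A $$ (i, i)) = (\<Sum>i<n. (P * (B * Q)) $$ (i, i))"
    unfolding PQ(3) assoc_mult_mat[OF PQ(6,5,7)] ..
  also have "\<dots> = (\<Sum>i<n. (B * Q * P) $$ (i, i))"
    using PQ by (intro trace_mult_commute) auto
  also have "B * Q * P = B"
    using PQ(5) by (simp add: assoc_mult_mat[OF PQ(5,7,6)] PQ(2))
  also have "(\<Sum>i<n. B $$ (i, i)) = sum_list es"
    unfolding diag[symmetric] diag_mat_def
    using PQ by (simp add: sum_list_sum_nth atLeast0LessThan)
  finally show ?thesis ..
qed

text \<open>Reduces algebraic multiplicity to counting in the list of eigenvalues: orders add up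
  over the factors.\<close>

lemma order_prod_linear_factors:
  "Polynomial.order c (\<Prod>e\<leftarrow>es. [:- e, 1:]) = count_list es (c :: complex)"
proof (induction es)
  case (Cons e es)
  have "Polynomial.order c [:- e, 1:] = (if c = e then 1 else 0)"
    using order_power_n_n[of e 1] by (simp add: order_0I)
  moreover have "(\<Prod>e\<leftarrow>es. [:- e, 1:]) \<noteq> 0"
    by (auto simp: prod_list_zero_iff)
  ultimately show ?case
    using Cons by (auto simp: order_mult simp del: mult_pCons_left)
qed simp

text \<open>Applying \<open>A\<close> twice scales an eigenvector both by \<open>a\<close> and by
  \<open>c ^ 2\<close>; a nonzero coordinate compares them.\<close>

lemma eigenvalue_square:
  fixes A :: "'a :: field mat"
  assumes A: "A \<in> carrier_mat n n" and sq: "A * A = a \<cdot>\<^sub>m 1\<^sub>m n" and "eigenvalue A c"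
  shows "c ^ 2 = a"
proof -
  obtain v where v: "v \<in> carrier_vec n" "v \<noteq> 0\<^sub>v n" "A *\<^sub>v v = c \<cdot>\<^sub>v v"
    using assms by (auto simp: eigenvalue_def eigenvector_def)
  have "a \<cdot>\<^sub>v v = (A * A) *\<^sub>v v"
    using v by (intro eq_vecI) (auto simp: sq)
  also have "\<dots> = A *\<^sub>v (A *\<^sub>v v)"
    using A v by (simp add: assoc_mult_mat_vec)
  also have "\<dots> = c ^ 2 \<cdot>\<^sub>v v"
    using A v by (simp add: mult_mat_vec smult_smult_assoc power2_eq_square)
  finally have eq: "a \<cdot>\<^sub>v v = c ^ 2 \<cdot>\<^sub>v v" .
  obtain i where "i < n" "v $ i \<noteq> 0"
    using v by (metis carrier_vecD eq_vecI index_zero_vec)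
  with arg_cong[OF eq, of "\<lambda>w. w $ i"] v show ?thesis
    by simp
qed

text \<open>The two multiplicities have sum \<open>n\<close>, the number of eigenvalues, and
  difference \<open>t\<close>, the trace divided by \<open>r\<close>.\<close>

lemma alg_multiplicity_square_root:
  assumes A: "A \<in> carrier_mat n n" and ev: "\<And>c. eigenvalue A c \<Longrightarrow> c = r \<or> c = - r" and r: "r \<noteq> 0"
    and tr: "(\<Sum>i<n. A $$ (i, i)) = r * complex_of_real t"
  shows "real (alg_multiplicity A r) = (real n + t) / 2"
    and "real (alg_multiplicity A (- r)) = (real n - t) / 2"
proof -
  obtain es where es: "char_poly A = (\<Prod>e\<leftarrow>es. [:- e, 1:])" and len: "length es = n"
    using char_poly_factorized[OF A] by blast
  have "e = r \<or> e = - r" if "e \<in> set es" for e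
    using that by (intro ev) (auto simp: eigenvalue_root_char_poly[OF A] es poly_prod_list prod_list_zero_iff)
  moreover have "r \<noteq> - r"
    using r by simp
  ultimately have "count_list es r + count_list es (- r) = length es
    \<and> sum_list es = r * (of_nat (count_list es r) - of_nat (count_list es (- r)))"
    by (induction es) (auto simp: algebra_simps)
  then have "count_list es r + count_list es (- r) = n"
    and "complex_of_real (real (count_list es r) - real (count_list es (- r))) = complex_of_real t"
    using r tr len sum_list_eigenvalues_eq_trace[OF A es] by simp_all
  then have "real (count_list es r) + real (count_list es (- r)) = real n"
    and "real (count_list es r) - real (count_list es (- r)) = t"
    by (metis of_nat_add, simp only: of_real_eq_iff)
  then show "real (alg_multiplicity A r) = (real n + t) / 2"
    and "real (alg_multiplicity A (- r)) = (real n - t) / 2"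
    unfolding alg_multiplicity_def es order_prod_linear_factors by simp_all
qed

section \<open>Spectrum of the rotation symmetric matrix\<close>

lemma rs_matrix_complex_carrier [simp]:
  "rs_matrix_complex n \<in> carrier_mat (num_orbits n) (num_orbits n)"
  by (simp add: rs_matrix_complex_def rs_matrix_def)

lemma rs_matrix_complex_square:
  "rs_matrix_complex n * rs_matrix_complex n = 2 ^ n \<cdot>\<^sub>m 1\<^sub>m (num_orbits n)"
proof -
  have "rs_matrix n \<in> carrier_mat (num_orbits n) (num_orbits n)"
    by (simp add: rs_matrix_def)
  then have "rs_matrix_complex n * rs_matrix_complex n = map_mat of_int (rs_matrix n * rs_matrix n)"
    unfolding rs_matrix_complex_def by (intro of_int_hom.mat_hom_mult[symmetric])
  also have "\<dots> = 2 ^ n \<cdot>\<^sub>m 1\<^sub>m (num_orbits n)"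
    unfolding rs_matrix_square by (intro eq_matI) auto
  finally show ?thesis .
qed

theorem theorem2:
  fixes n :: nat
  assumes "n > 2"
  defines "A \<equiv> rs_matrix_complex n"
    and "r \<equiv> complex_of_real (2 powr (real n / 2))"
    and "g \<equiv> real (num_orbits n)"
    and "S \<equiv> (\<Sum>k | k dvd n \<and> even k. real (totient k) * 2 ^ (n div k))"
  shows "(\<forall>c. eigenvalue A c \<longrightarrow> c = r \<or> c = - r) \<and>
    (odd n \<longrightarrow>
      real (alg_multiplicity A r) = g / 2 \<and>
      real (alg_multiplicity A (- r)) = g / 2) \<and>
    (even n \<longrightarrow>
      real (alg_multiplicity A r) = g / 2 + 1 / (2 * real n) * S \<and>
      real (alg_multiplicity A (- r)) = g / 2 - 1 / (2 * real n) * S)"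
proof -
  have carrier: "A \<in> carrier_mat (num_orbits n) (num_orbits n)"
    by (simp add: A_def)
  have r: "r \<noteq> 0"
    by (simp add: r_def)
  have "(2 powr (real n / 2)) ^ 2 = (2 :: real) ^ n"
    by (simp add: powr_power powr_realpow)
  then have r2: "r ^ 2 = 2 ^ n"
    unfolding r_def by (metis of_real_power of_real_numeral)
  have ev: "c = r \<or> c = - r" if "eigenvalue A c" for c
  proof -
    have "c ^ 2 = r ^ 2"
      using eigenvalue_square[OF carrier _ that] r2 by (simp add: A_def rs_matrix_complex_square)
    then show ?thesis
      by (simp only: power2_eq_iff)
  qed
  have S_odd: "S = 0" if "odd n"
    using that unfolding S_def by (intro sum.neutral) auto
  \<comment> \<open>For odd \<open>n\<close> the two powers differ, but both sides vanish with
    \<open>S\<close>.\<close>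
  have "2 ^ (n div 2) * S = 2 powr (real n / 2) * S"
  proof (cases "even n")
    case True
    then show ?thesis
      by (auto simp: powr_realpow[symmetric] elim!: evenE)
  qed (simp add: S_odd)
  then have "real_of_int (\<Sum>k<n. autocorrelation_sum n k) = 2 powr (real n / 2) * S"
    using assms(1) by (simp add: sum_autocorrelation_sum S_def)
  then have "real n * real_of_int (\<Sum>i<num_orbits n. rs_matrix n $$ (i, i)) = 2 powr (real n / 2) * S"
    unfolding rs_matrix_trace[symmetric] by simp
  then have "real_of_int (\<Sum>i<num_orbits n. rs_matrix n $$ (i, i)) = 2 powr (real n / 2) * (S / n)"
    using assms(1) by (simp add: field_simps)
  moreover have "(\<Sum>i<num_orbits n. A $$ (i, i))
      = complex_of_real (real_of_int (\<Sum>i<num_orbits n. rs_matrix n $$ (i, i)))"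
    using carrier by (simp add: A_def rs_matrix_complex_def)
  \<comment> \<open>This puts the trace in the form \<open>r * t\<close> with
    \<open>t = S / n\<close>, the difference of the two multiplicities.\<close>
  ultimately have "(\<Sum>i<num_orbits n. A $$ (i, i)) = r * complex_of_real (S / n)"
    by (simp add: r_def)
  from alg_multiplicity_square_root[OF carrier ev r this]
  have "real (alg_multiplicity A r) = g / 2 + 1 / (2 * real n) * S"
    and "real (alg_multiplicity A (- r)) = g / 2 - 1 / (2 * real n) * S"
    by (simp_all add: g_def add_divide_distrib diff_divide_distrib)
  with ev S_odd show ?thesis
    by simp
qed

end
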